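(* Let $\Phi:\mathbb{M}(n)\to\mathbb{M}(k)$ be a positive unital linear map. Let $A\in\mathbb{M}(n)$ be a Hermitian matrix whose spectrum is contained in the real interval $[m,M]$. Then for every $r=0,1,2,\ldots$, $$\left[\Phi(A^{i+j-2})\right]_{1\le i,j\le r+1}\ge O.$$ If moreover $A\ge O$, then also, for every $r=0,1,2,\ldots$, $$\left[\Phi(A^{i+j-1})\right]_{1\le i,j\le r+1}\ge O.$$
   Context: $\mathbb{M}(n)$ is the $C^*$-algebra of all $n\times n$ complex matrices. A linear map $\Phi:\mathbb{M}(n)\to\mathbb{M}(k)$ is positive if it sends positive semidefinite matrices to positive semidefinite matrices, and unital if $\Phi(I)=I$. $[X_{ij}]_{1\le i,j\le r+1}$ with $X_{ij}\in\mathbb{M}(k)$ denotes the $(r+1)\times(r+1)$ block matrix with blocks $X_{ij}$, viewed as an element of $\mathbb{M}((r+1)k)$. $X\ge O$ means $X$ is Hermitian positive semidefinite. $A^0=I$. *)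

theory Defs
  imports
    "Jordan_Normal_Form.Schur_Decomposition"
    "Jordan_Normal_Form.Spectral_Radius"
    "Jordan_Normal_Form.VS_Connect"
begin

definition hermitian_mat :: "complex mat \<Rightarrow> bool" where
  "hermitian_mat A \<longleftrightarrow> mat_adjoint A = A"

text \<open>The order on the complex numbers is the one of \<open>Complex_Order\<close>:
  \<open>0 \<le> z\<close> says that \<open>z\<close> is real and nonnegative. The scalar
  \<open>(A *\<^sub>v v) \<bullet>c v\<close> is the quadratic form $v^* A v$.\<close>

definition psd_mat :: "nat \<Rightarrow> complex mat \<Rightarrow> bool" where
  "psd_mat n A \<longleftrightarrow> A \<in> carrier_mat n n \<and> hermitian_mat A \<and>
     (\<forall>v \<in> carrier_vec n. 0 \<le> (A *\<^sub>v v) \<bullet>c v)"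

text \<open>Maps between matrix algebras are functions on the type of matrices of all sizes;
  only their values on the carrier of \<open>n \<times> n\<close> matrices are constrained.\<close>

definition linear_mat_map :: "nat \<Rightarrow> nat \<Rightarrow> (complex mat \<Rightarrow> complex mat) \<Rightarrow> bool" where
  "linear_mat_map n k \<Phi> \<longleftrightarrow>
     linear_map class_ring (module_mat TYPE(complex) n n) (module_mat TYPE(complex) k k) \<Phi>"

definition positive_mat_map :: "nat \<Rightarrow> nat \<Rightarrow> (complex mat \<Rightarrow> complex mat) \<Rightarrow> bool" where
  "positive_mat_map n k \<Phi> \<longleftrightarrow> (\<forall>X. psd_mat n X \<longrightarrow> psd_mat k (\<Phi> X))"

definition unital_mat_map :: "nat \<Rightarrow> nat \<Rightarrow> (complex mat \<Rightarrow> complex mat) \<Rightarrow> bool" where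
  "unital_mat_map n k \<Phi> \<longleftrightarrow> \<Phi> (1\<^sub>m n) = 1\<^sub>m k"

text \<open>The \<open>p \<times> p\<close> block matrix with \<open>k \<times> k\<close> blocks \<open>X i j\<close>, where
  \<open>1 \<le> i, j \<le> p\<close>, as a \<open>pk \<times> pk\<close> matrix. Block indices start at 1, whereas the
  entries of library matrices are indexed from 0.\<close>

definition block_matrix :: "nat \<Rightarrow> nat \<Rightarrow> (nat \<Rightarrow> nat \<Rightarrow> complex mat) \<Rightarrow> complex mat" where
  "block_matrix k p X =
     mat (p * k) (p * k) (\<lambda>(a, b). X (a div k + 1) (b div k + 1) $$ (a mod k, b mod k))"

end

theory Submission
  imports Defs
begin

text \<open>By the spectral theorem $A^q = \sum_l d_l^q P_l$ with real $d_l$ and positive semidefinite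
  $P_l$ of rank one, so $\Phi(A^q) = \sum_l d_l^q \Phi(P_l)$. The block matrix of the
  $\Phi(A^{i+j-2+s})$ is therefore $\sum_l d_l^s [d_l^{i+j-2} \Phi(P_l)]_{ij}$, where each block
  matrix is the Kronecker product of the rank-one matrix $[d_l^{i+j-2}]_{ij}$ with a positive
  semidefinite matrix. The weights $d_l^s$ are nonnegative for $s = 0$, and for $s = 1$ if
  $A \ge O$.\<close>

section \<open>Entrywise calculus for adjoints and products\<close>

lemma mat_adjoint_dim [simp]:
  "dim_row (mat_adjoint A) = dim_col A" "dim_col (mat_adjoint A) = dim_row A"
  unfolding mat_adjoint_def by auto

lemma mat_adjoint_carrier [simp, intro]:
  "A \<in> carrier_mat nr nc \<Longrightarrow> mat_adjoint A \<in> carrier_mat nc nr"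
  by (intro carrier_matI) auto

lemma mat_adjoint_index [simp]:
  "i < dim_col A \<Longrightarrow> j < dim_row A \<Longrightarrow> mat_adjoint A $$ (i, j) = conjugate (A $$ (j, i))"
  unfolding mat_adjoint_def by (auto simp: mat_of_rows_index cols_def)

lemma mat_adjoint_mat:
  "mat_adjoint (mat nr nc f) = mat nc nr (\<lambda>(i, j). conjugate (f (j, i)))"
  by (intro eq_matI) auto

lemma mat_mult_index_sum:
  assumes "A \<in> carrier_mat nr n" "B \<in> carrier_mat n nc" "i < nr" "j < nc"
  shows "(A * B) $$ (i, j) = (\<Sum>k<n. A $$ (i, k) * B $$ (k, j))"
  using assms by (auto simp: scalar_prod_def atLeast0LessThan intro!: sum.cong)

lemma mult_diag_mat_index:
  fixes c :: "nat \<Rightarrow> 'a :: comm_semiring_1"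
  assumes U: "U \<in> carrier_mat nr n" and i: "i < nr" and l: "l < n"
  shows "(U * mat n n (\<lambda>(i, j). if i = j then c i else 0)) $$ (i, l) = c l * U $$ (i, l)"
proof -
  have "(U * mat n n (\<lambda>(i, j). if i = j then c i else 0)) $$ (i, l) =
      (\<Sum>k<n. U $$ (i, k) * (if k = l then c k else 0))"
    using i l by (subst mat_mult_index_sum[OF U]) auto
  also have "\<dots> = c l * U $$ (i, l)"
    using l by (simp add: if_distrib sum.delta mult.commute cong: if_cong)
  finally show ?thesis .
qed

lemma mat_adjoint_mult:
  fixes A B :: "complex mat"
  assumes A: "A \<in> carrier_mat nr n" and B: "B \<in> carrier_mat n nc"
  shows "mat_adjoint (A * B) = mat_adjoint B * mat_adjoint A"
proof (rule eq_matI)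
  fix i j assume "i < dim_row (mat_adjoint B * mat_adjoint A)" 
    "j < dim_col (mat_adjoint B * mat_adjoint A)"
  then have i: "i < nc" and j: "j < nr" using A B by auto
  have "mat_adjoint (A * B) $$ (i, j) = cnj ((A * B) $$ (j, i))"
    using i j A B by (subst mat_adjoint_index) auto
  also have "\<dots> = (\<Sum>k<n. cnj (A $$ (j, k)) * cnj (B $$ (k, i)))"
    using mat_mult_index_sum[OF A B j i] by simp
  also have "\<dots> = (\<Sum>k<n. mat_adjoint B $$ (i, k) * mat_adjoint A $$ (k, j))"
    using i j A B by (intro sum.cong) auto
  also have "\<dots> = (mat_adjoint B * mat_adjoint A) $$ (i, j)"
    using mat_mult_index_sum[OF mat_adjoint_carrier[OF B] mat_adjoint_carrier[OF A] i j] by simp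
  finally show "mat_adjoint (A * B) $$ (i, j) = (mat_adjoint B * mat_adjoint A) $$ (i, j)" .
qed (use A B in auto)

lemma mat_adjoint_adjoint [simp]: "mat_adjoint (mat_adjoint A) = A"
  by (intro eq_matI) auto

section \<open>Unitary diagonalization of Hermitian matrices and their powers\<close>

text \<open>Gram-Schmidt, started from a basis whose first member is \<open>v\<close>, leaves
  \<open>v\<close> in place; dividing the resulting orthogonal vectors by their norms gives the
  columns of \<open>U\<close>. The scalar \<open>c\<close> absorbs the normalization of
  \<open>v\<close>.\<close>

lemma unitary_completion:
  fixes v :: "complex vec"
  assumes v: "v \<in> carrier_vec n" and v0: "v \<noteq> 0\<^sub>v n"
  obtains U c where "U \<in> carrier_mat n n" "mat_adjoint U * U = 1\<^sub>m n" "col U 0 = c \<cdot>\<^sub>v v"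
proof -
  interpret cof_vec_space n "TYPE(complex)" .
  define b where "b = basis_completion v"
  define ws where "ws = gram_schmidt n b"
  from basis_completion[OF v v0, folded b_def]
  have dist_b: "distinct b" and indep: "\<not> lin_dep (set b)" and b: "set b \<subseteq> carrier_vec n"
    and hdb: "hd b = v" and len_b: "length b = n" by auto
  have n: "n > 0" using v v0 by (cases n) auto
  from hdb len_b n obtain vs where bv: "b = v # vs" by (cases b) auto
  from gram_schmidt_result[OF b dist_b indep refl, folded ws_def]
  have ws: "set ws \<subseteq> carrier_vec n" and orth: "corthogonal ws" and len: "length ws = n"
    by (auto simp: len_b)
  from gram_schmidt_hd[OF v, of vs, folded bv] have hdws: "hd ws = v" unfolding ws_def .
  have ws0: "ws ! 0 = v" using hdws len n by (cases ws) auto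
  have wsc: "ws ! j \<in> carrier_vec n" if "j < n" for j using ws len that by auto
  \<comment> \<open>The norm of the vector \<open>ws ! j\<close>: \<open>gram_schmidt\<close> yields
    nonzero orthogonal vectors that are not normalized. The inner product is a complex number with
    zero imaginary part, hence the \<open>Re\<close>.\<close>
  define s where "s j = sqrt (Re (ws ! j \<bullet>c ws ! j))" for j
  have s: "ws ! j \<bullet>c ws ! j = complex_of_real (s j) * complex_of_real (s j)" "s j \<noteq> 0"
    if j: "j < n" for j
  proof -
    have "ws ! j \<bullet>c ws ! j \<noteq> 0" using corthogonalD[OF orth, of j j] j len by auto
    moreover have "ws ! j \<bullet>c ws ! j \<ge> 0" by auto
    ultimately have *: "Re (ws ! j \<bullet>c ws ! j) > 0" "Im (ws ! j \<bullet>c ws ! j) = 0"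
      by (auto simp: less_eq_complex_def complex_eq_iff)
    then show "s j \<noteq> 0" by (simp add: s_def)
    have "s j * s j = Re (ws ! j \<bullet>c ws ! j)" using * by (simp add: s_def)
    then show "ws ! j \<bullet>c ws ! j = complex_of_real (s j) * complex_of_real (s j)"
      using * by (simp add: complex_eq_iff)
  qed
  define U where "U = mat n n (\<lambda>(i, j). ws ! j $ i / complex_of_real (s j))"
  have U: "U \<in> carrier_mat n n" by (simp add: U_def)
  show thesis
  proof (rule that[OF U])
    show "mat_adjoint U * U = 1\<^sub>m n"
    proof (rule eq_matI)
      fix i j assume "i < dim_row (1\<^sub>m n :: complex mat)" "j < dim_col (1\<^sub>m n :: complex mat)"
      then have i: "i < n" and j: "j < n" by auto
      have "(mat_adjoint U * U) $$ (i, j) =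
          (\<Sum>k<n. ws ! j $ k * cnj (ws ! i $ k) / (complex_of_real (s i) * complex_of_real (s j)))"
        using mat_mult_index_sum[OF mat_adjoint_carrier[OF U] U i j] i j
        by (auto simp: U_def field_simps intro!: sum.cong)
      also have "\<dots> = (ws ! j \<bullet>c ws ! i) / (complex_of_real (s i) * complex_of_real (s j))"
        using wsc[OF i] wsc[OF j]
        by (simp add: scalar_prod_def sum_divide_distrib atLeast0LessThan)
      also have "\<dots> = 1\<^sub>m n $$ (i, j)"
        using s[OF i] corthogonalD[OF orth, of j i] i j len by auto
      finally show "(mat_adjoint U * U) $$ (i, j) = 1\<^sub>m n $$ (i, j)" .
    qed (use U in auto)
    show "col U 0 = (1 / complex_of_real (s 0)) \<cdot>\<^sub>v v"
      using n v by (intro eq_vecI) (auto simp: U_def ws0)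
  qed
qed

text \<open>Deflation by induction on the size: in a unitary basis that starts with an eigenvector,
  a Hermitian matrix splits into a 1 x 1 block and a smaller Hermitian block, to which the induction
  hypothesis applies. Symmetry forces the eigenvalues to be real.\<close>

lemma hermitian_unitary_diagonalization:
  assumes "A \<in> carrier_mat n n" and "mat_adjoint A = A"
  obtains U and d :: "nat \<Rightarrow> real" where "U \<in> carrier_mat n n" "mat_adjoint U * U = 1\<^sub>m n"
    "A * U = U * mat n n (\<lambda>(i, j). if i = j then complex_of_real (d i) else 0)"
proof -
  define D where "D n d = mat n n (\<lambda>(i, j). if i = j then complex_of_real (d i) else 0)"
    for n and d :: "nat \<Rightarrow> real"
  have D[simp]: "D n d \<in> carrier_mat n n" for n d by (simp add: D_def)
  have "\<exists>U d. U \<in> carrier_mat n n \<and> mat_adjoint U * U = 1\<^sub>m n \<and> A * U = U * D n d"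
    using assms
  proof (induction n arbitrary: A)
    case 0
    then show ?case by (intro exI[of _ "1\<^sub>m 0"] exI[of _ "\<lambda>_. 0"]) (auto simp: D_def intro!: eq_matI)
  next
    case (Suc n A)
    note A = Suc.prems(1)
    from spectrum_non_empty[OF A] obtain e where "eigenvalue A e" by (auto simp: spectrum_def)
    then obtain v where v: "v \<in> carrier_vec (Suc n)" "v \<noteq> 0\<^sub>v (Suc n)" "A *\<^sub>v v = e \<cdot>\<^sub>v v"
      using A by (auto simp: eigenvalue_def eigenvector_def)
    from unitary_completion[OF v(1,2)] obtain W c
      where W: "W \<in> carrier_mat (Suc n) (Suc n)" and WW: "mat_adjoint W * W = 1\<^sub>m (Suc n)"
        and col: "col W 0 = c \<cdot>\<^sub>v v" .
    note Wa = mat_adjoint_carrier[OF W]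
    \<comment> \<open>A left inverse of a square matrix is also a right inverse; this side is what
      turns \<open>C\<close> back into \<open>A * W = W * C\<close>.\<close>
    have WW': "W * mat_adjoint W = 1\<^sub>m (Suc n)"
      by (rule mat_mult_left_right_inverse[OF Wa W WW])
    define C where "C = mat_adjoint W * (A * W)"
    have AW: "A * W \<in> carrier_mat (Suc n) (Suc n)" using A W by auto
    have C: "C \<in> carrier_mat (Suc n) (Suc n)" using Wa AW by (auto simp: C_def)
    have Ch: "mat_adjoint C = C"
      unfolding C_def mat_adjoint_mult[OF Wa AW] mat_adjoint_mult[OF A W] Suc.prems(2)
      using A W Wa by (simp add: assoc_mult_mat[of _ "Suc n" "Suc n" _ "Suc n" _ "Suc n"])
    have Csym: "cnj (C $$ (j, i)) = C $$ (i, j)" if "i < Suc n" "j < Suc n" for i j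
      using arg_cong[OF Ch, of "\<lambda>M. M $$ (i, j)"] that C by simp
    have AWC: "A * W = W * C"
      unfolding C_def using assoc_mult_mat[OF W Wa AW] left_mult_one_mat[OF AW] by (simp add: WW')
    have "col (A * W) 0 = e \<cdot>\<^sub>v col W 0"
      using A W v by (subst col_mult2[OF A W]) (auto simp: col mult_mat_vec smult_smult_assoc mult.commute)
    then have AW0: "(A * W) $$ (i, 0) = e * W $$ (i, 0)" if "i < Suc n" for i
      using arg_cong[of _ _ "\<lambda>w. w $ i"] that A W by (auto simp: vec_eq_iff)
    \<comment> \<open>The first column of \<open>W\<close> is an eigenvector, so the first column of
      \<open>C\<close> is \<open>e\<close> times the first column of
      \<open>mat_adjoint W * W\<close>, the identity.\<close>
    have C0: "C $$ (i, 0) = (if i = 0 then e else 0)" if i: "i < Suc n" for i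
    proof -
      have "C $$ (i, 0) = (\<Sum>k<Suc n. mat_adjoint W $$ (i, k) * (A * W) $$ (k, 0))"
        unfolding C_def using mat_mult_index_sum[OF Wa AW i] by simp
      also have "\<dots> = e * (\<Sum>k<Suc n. mat_adjoint W $$ (i, k) * W $$ (k, 0))"
        unfolding sum_distrib_left by (intro sum.cong) (auto simp: AW0 simp del: mat_adjoint_index)
      also have "\<dots> = e * (mat_adjoint W * W) $$ (i, 0)"
        using mat_mult_index_sum[OF Wa W i] by simp
      finally show ?thesis using i by (simp add: WW)
    qed
    \<comment> \<open>\<open>e\<close> is a diagonal entry of the Hermitian matrix
      \<open>C\<close>.\<close>
    have "cnj e = e" using Csym[of 0 0] C0[of 0] by simp
    then obtain x where x: "e = complex_of_real x" by (metis Reals_cases Reals_cnj_iff)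
    \<comment> \<open>Conjugate symmetry transfers the zeros of the first column to the first row,
      so \<open>C\<close> is block diagonal and not merely block triangular.\<close>
    have Cr0: "C $$ (0, j) = (if j = 0 then e else 0)" if "j < Suc n" for j
      by (subst Csym[symmetric]) (use that C0[OF that] \<open>cnj e = e\<close> in auto)
    define C3 where "C3 = mat n n (\<lambda>(i, j). C $$ (Suc i, Suc j))"
    have C3: "C3 \<in> carrier_mat n n" by (simp add: C3_def)
    have Cblock: "C = four_block_mat (mat 1 1 (\<lambda>_. e)) (0\<^sub>m 1 n) (0\<^sub>m n 1) C3"
      using C C0 Cr0 by (intro eq_matI) (auto simp: C3_def)
    have "mat_adjoint C3 = C3"
      unfolding C3_def mat_adjoint_mat using Csym by (intro eq_matI) auto
    from Suc.IH[OF C3 this] obtain U d where U: "U \<in> carrier_mat n n"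
      and UU: "mat_adjoint U * U = 1\<^sub>m n" and CU: "C3 * U = U * D n d" by auto
    \<comment> \<open>The smaller unitary is extended by acting trivially on the eigenvector;
      \<open>W * F\<close> will diagonalize \<open>A\<close>.\<close>
    define F where "F = four_block_mat (1\<^sub>m 1) (0\<^sub>m 1 n) (0\<^sub>m n 1) U"
    have F: "F \<in> carrier_mat (Suc n) (Suc n)"
      using four_block_carrier_mat[OF one_carrier_mat[of 1] U] by (simp add: F_def)
    have Fa: "mat_adjoint F = four_block_mat (1\<^sub>m 1) (0\<^sub>m 1 n) (0\<^sub>m n 1) (mat_adjoint U)"
      using U by (intro eq_matI) (auto simp: F_def)
    have FF: "mat_adjoint F * F = 1\<^sub>m (Suc n)"
      unfolding Fa unfolding F_def
      using U UU by (subst mult_four_block_mat[of _ 1 1 _ n _ n _ _ 1 _ n]) (auto intro!: eq_matI)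
    \<comment> \<open>The new eigenvalue takes position 0 and the old ones move up by one.\<close>
    define d' where "d' i = (if i = 0 then x else d (i - 1))" for i
    have D': "D (Suc n) d' = four_block_mat (mat 1 1 (\<lambda>_. e)) (0\<^sub>m 1 n) (0\<^sub>m n 1) (D n d)"
      by (intro eq_matI) (auto simp: D_def d'_def x)
    have CF: "C * F = F * D (Suc n) d'"
      unfolding Cblock F_def D'
      using U C3 CU 
      by (subst (1 2) mult_four_block_mat[of _ 1 1 _ n _ n _ _ 1 _ n])
        (auto simp: left_mult_zero_mat[OF D])
    define V where "V = W * F"
    have V: "V \<in> carrier_mat (Suc n) (Suc n)" using W F by (simp add: V_def)
    note assoc = assoc_mult_mat[of _ "Suc n" "Suc n" _ "Suc n" _ "Suc n"]
    have "mat_adjoint V * V = mat_adjoint F * ((mat_adjoint W * W) * F)"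
      unfolding V_def mat_adjoint_mult[OF W F] using W F by (simp add: assoc)
    then have VV: "mat_adjoint V * V = 1\<^sub>m (Suc n)" using F by (simp add: WW FF)
    have "A * V = (A * W) * F" using A W F by (simp add: V_def assoc)
    also have "\<dots> = W * (C * F)" using C W F by (simp add: AWC assoc)
    also have "\<dots> = V * D (Suc n) d'" using W F by (simp add: CF V_def assoc)
    finally show ?case using V VV by blast
  qed
  then show thesis using that unfolding D_def by blast
qed

text \<open>Writing u_l for the columns of \<open>U\<close>, this is the expansion of A^p as the sum
  of d_l^p u_l u_l^*. For p = 0 it is the resolution of the identity U U^* = I; each further factor
  \<open>A\<close> contributes one d_l because A u_l = d_l u_l.\<close>

lemma hermitian_pow_spectral:
  fixes d :: "nat \<Rightarrow> real"
  assumes A: "A \<in> carrier_mat n n" and U: "U \<in> carrier_mat n n"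
    and UU: "mat_adjoint U * U = 1\<^sub>m n"
    and AU: "A * U = U * mat n n (\<lambda>(i, j). if i = j then complex_of_real (d i) else 0)"
  shows "A ^\<^sub>m p =
    mat n n (\<lambda>(i, j). \<Sum>l<n. complex_of_real (d l ^ p) * (U $$ (i, l) * cnj (U $$ (j, l))))"
    (is "_ = ?R p")
proof (induction p)
  note Ua = mat_adjoint_carrier[OF U]
  case 0
  show ?case
  proof (rule eq_matI)
    fix i j assume "i < dim_row (?R 0)" "j < dim_col (?R 0)"
    then have i: "i < n" and j: "j < n" by auto
    have "(A ^\<^sub>m 0) $$ (i, j) = (U * mat_adjoint U) $$ (i, j)"
      using mat_mult_left_right_inverse[OF Ua U UU] A by simp
    then show "(A ^\<^sub>m 0) $$ (i, j) = ?R 0 $$ (i, j)"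
      using mat_mult_index_sum[OF U Ua i j] U i j by simp
  qed (use A in auto)
next
  case (Suc p)
  have R: "?R p \<in> carrier_mat n n" by simp
  \<comment> \<open>Matrix powers unfold with the new factor on the right, but the eigenvector
    equation needs it on the left, next to the columns of \<open>U\<close>.\<close>
  have comm: "A ^\<^sub>m Suc p = A * A ^\<^sub>m p"
  proof (induction p)
    case (Suc p)
    have "A ^\<^sub>m Suc (Suc p) = A * A ^\<^sub>m p * A" unfolding Suc[symmetric] by simp
    then show ?case using A by (simp add: assoc_mult_mat[of _ n n _ n _ n])
  qed (use A in auto)
  have AUl: "(\<Sum>k<n. A $$ (i, k) * U $$ (k, l)) = complex_of_real (d l) * U $$ (i, l)"
    if "i < n" "l < n" for i l
  proof -
    have "(\<Sum>k<n. A $$ (i, k) * U $$ (k, l)) = (A * U) $$ (i, l)"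
      using mat_mult_index_sum[OF A U that] by simp
    also have "\<dots> = complex_of_real (d l) * U $$ (i, l)"
      unfolding AU by (rule mult_diag_mat_index[OF U that])
    finally show ?thesis .
  qed
  show ?case
  proof (rule eq_matI)
    fix i j assume "i < dim_row (?R (Suc p))" "j < dim_col (?R (Suc p))"
    then have i: "i < n" and j: "j < n" by auto
    have "(A ^\<^sub>m Suc p) $$ (i, j) = (A * ?R p) $$ (i, j)"
      unfolding comm Suc.IH ..
    also have "\<dots> = (\<Sum>k<n. \<Sum>l<n. complex_of_real (d l ^ p) * cnj (U $$ (j, l)) * (A $$ (i, k) * U $$ (k, l)))"
      unfolding mat_mult_index_sum[OF A R i j]
      using j by (auto simp: sum_distrib_left algebra_simps intro!: sum.cong)
    also have "\<dots> = (\<Sum>l<n. complex_of_real (d l ^ p) * cnj (U $$ (j, l)) * (\<Sum>k<n. A $$ (i, k) * U $$ (k, l)))"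
      by (subst sum.swap) (simp add: sum_distrib_left)
    also have "\<dots> = ?R (Suc p) $$ (i, j)"
      using i j by (auto simp: AUl algebra_simps intro!: sum.cong)
    finally show "(A ^\<^sub>m Suc p) $$ (i, j) = ?R (Suc p) $$ (i, j)" .
  qed (use A in auto)
qed

section \<open>Positive semidefinite matrices in coordinates\<close>

lemma quadratic_form_sum:
  fixes X :: "complex mat"
  assumes "X \<in> carrier_mat n n" "v \<in> carrier_vec n"
  shows "(X *\<^sub>v v) \<bullet>c v = (\<Sum>a<n. \<Sum>b<n. X $$ (a, b) * v $ b * cnj (v $ a))"
  using assms by (auto simp: scalar_prod_def atLeast0LessThan sum_distrib_right intro!: sum.cong)

text \<open>Test vectors become arbitrary functions on \<open>nat\<close>, of which only the values
  below \<open>n\<close> enter. Later arguments can then reindex sums freely, without carrier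
  conditions on vectors.\<close>

lemma psd_mat_iff:
  "psd_mat n X \<longleftrightarrow> X \<in> carrier_mat n n \<and> (\<forall>i<n. \<forall>j<n. cnj (X $$ (j, i)) = X $$ (i, j)) \<and>
     (\<forall>v :: nat \<Rightarrow> complex. 0 \<le> (\<Sum>a<n. \<Sum>b<n. X $$ (a, b) * v b * cnj (v a)))"
proof (cases "X \<in> carrier_mat n n")
  case X: True
  have "hermitian_mat X \<longleftrightarrow> (\<forall>i<n. \<forall>j<n. cnj (X $$ (j, i)) = X $$ (i, j))"
  proof
    assume "hermitian_mat X"
    then have "cnj (X $$ (j, i)) = X $$ (i, j)" if "i < n" "j < n" for i j
      using mat_adjoint_index[of i X j] X that by (simp add: hermitian_mat_def)
    then show "\<forall>i<n. \<forall>j<n. cnj (X $$ (j, i)) = X $$ (i, j)" by blast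
  next
    assume "\<forall>i<n. \<forall>j<n. cnj (X $$ (j, i)) = X $$ (i, j)"
    then show "hermitian_mat X"
      unfolding hermitian_mat_def using X by (intro eq_matI) auto
  qed
  moreover have "(\<forall>v \<in> carrier_vec n. 0 \<le> (X *\<^sub>v v) \<bullet>c v) \<longleftrightarrow>
    (\<forall>v :: nat \<Rightarrow> complex. 0 \<le> (\<Sum>a<n. \<Sum>b<n. X $$ (a, b) * v b * cnj (v a)))" (is "?L \<longleftrightarrow> ?R")
  proof
    assume L: ?L
    show ?R
    proof
      fix v :: "nat \<Rightarrow> complex"
      show "0 \<le> (\<Sum>a<n. \<Sum>b<n. X $$ (a, b) * v b * cnj (v a))"
        using L[rule_format, of "vec n v"] by (simp add: quadratic_form_sum[OF X])
    qed
  qed (simp add: quadratic_form_sum[OF X])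
  ultimately show ?thesis using X by (simp add: psd_mat_def)
qed (simp add: psd_mat_def)

lemma psd_matD:
  assumes "psd_mat n X"
  shows psd_mat_carrier: "X \<in> carrier_mat n n"
    and psd_mat_cnj: "i < n \<Longrightarrow> j < n \<Longrightarrow> cnj (X $$ (j, i)) = X $$ (i, j)"
    and psd_mat_form: "0 \<le> (\<Sum>a<n. \<Sum>b<n. X $$ (a, b) * v b * cnj (v a))"
  using assms by (simp_all add: psd_mat_iff)

text \<open>The quadratic form of u u^* at v factors as |w|^2, where w is the inner product of u and
  v.\<close>

lemma psd_mat_rank_one:
  "psd_mat n (mat n n (\<lambda>(i, j). u i * cnj (u j)))"
  unfolding psd_mat_iff
proof (intro conjI allI impI)
  fix v :: "nat \<Rightarrow> complex"
  define w where "w = (\<Sum>a<n. u a * cnj (v a))"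
  have "(\<Sum>a<n. \<Sum>b<n. mat n n (\<lambda>(i, j). u i * cnj (u j)) $$ (a, b) * v b * cnj (v a)) = w * cnj w"
    by (simp add: w_def sum_product mult_ac)
  also have "0 \<le> w * cnj w" by (simp add: less_eq_complex_def)
  finally show "0 \<le> (\<Sum>a<n. \<Sum>b<n. mat n n (\<lambda>(i, j). u i * cnj (u j)) $$ (a, b) * v b * cnj (v a))" .
qed auto

lemma psd_mat_sum:
  fixes c :: "nat \<Rightarrow> real"
  assumes c: "\<And>l. l < N \<Longrightarrow> 0 \<le> c l" and X: "\<And>l. l < N \<Longrightarrow> psd_mat n (X l)"
  shows "psd_mat n (mat n n (\<lambda>(i, j). \<Sum>l<N. complex_of_real (c l) * X l $$ (i, j)))"
    (is "psd_mat n ?S")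
  unfolding psd_mat_iff
proof (intro conjI allI impI)
  fix v :: "nat \<Rightarrow> complex"
  have "(\<Sum>a<n. \<Sum>b<n. ?S $$ (a, b) * v b * cnj (v a)) =
      (\<Sum>a<n. \<Sum>b<n. \<Sum>l<N. complex_of_real (c l) * (X l $$ (a, b) * v b * cnj (v a)))"
    by (simp add: sum_distrib_right mult.assoc)
  also have "\<dots> = (\<Sum>a<n. \<Sum>l<N. \<Sum>b<n. complex_of_real (c l) * (X l $$ (a, b) * v b * cnj (v a)))"
    by (intro sum.cong refl sum.swap)
  also have "\<dots> = (\<Sum>l<N. complex_of_real (c l) * (\<Sum>a<n. \<Sum>b<n. X l $$ (a, b) * v b * cnj (v a)))"
    by (subst sum.swap) (simp add: sum_distrib_left)
  also have "0 \<le> \<dots>"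
  proof (rule sum_nonneg)
    fix l assume "l \<in> {..<N}"
    then have l: "l < N" by simp
    have "0 \<le> complex_of_real (c l)" using c[OF l] by (simp add: less_eq_complex_def)
    then show "0 \<le> complex_of_real (c l) * (\<Sum>a<n. \<Sum>b<n. X l $$ (a, b) * v b * cnj (v a))"
      using psd_mat_form[OF X[OF l]] by (rule mult_nonneg_nonneg)
  qed
  finally show "0 \<le> (\<Sum>a<n. \<Sum>b<n. ?S $$ (a, b) * v b * cnj (v a))" .
next
  fix i j assume "i < n" "j < n"
  then show "cnj (?S $$ (j, i)) = ?S $$ (i, j)"
    using psd_mat_cnj[OF X] by (auto intro!: sum.cong)
qed auto

section \<open>Block matrices and Kronecker products\<close>

text \<open>Every flat index below \<open>p * k\<close> is uniquely \<open>i * k + x\<close> with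
  block number \<open>i\<close> and offset \<open>x\<close>. This turns the quadratic form of a
  block matrix into sums over blocks and offsets.\<close>

lemma sum_div_mod:
  fixes f :: "nat \<Rightarrow> nat \<Rightarrow> 'a :: comm_monoid_add"
  shows "(\<Sum>a<p * k. f (a div k) (a mod k)) = (\<Sum>i<p. \<Sum>x<k. f i x)"
proof -
  have "(\<Sum>a<p * k. f (a div k) (a mod k)) = (\<Sum>i<p. \<Sum>a = i * k..<i * k + k. f (a div k) (a mod k))"
    by (rule sum.nat_group[symmetric])
  also have "\<dots> = (\<Sum>i<p. \<Sum>x<k. f i x)"
  proof (rule sum.cong[OF refl])
    fix i
    show "(\<Sum>a = i * k..<i * k + k. f (a div k) (a mod k)) = (\<Sum>x<k. f i x)"
      using sum.shift_bounds_nat_ivl[of "\<lambda>a. f (a div k) (a mod k)" 0 "i * k" k]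
      by (simp add: atLeast0LessThan add.commute)
  qed
  finally show ?thesis .
qed

text \<open>The quadratic form at v collapses to that of \<open>G\<close> at the single vector w =
  sum of t^i v_i, where v_i are the length-\<open>k\<close> blocks of v numbered from 0. As t is
  real, conjugation leaves its powers alone, so a negative t is allowed.\<close>

lemma psd_mat_hankel_kronecker:
  fixes t :: real
  assumes G: "psd_mat k G"
  shows "psd_mat (p * k) (block_matrix k p (\<lambda>i j. complex_of_real (t ^ (i + j - 2)) \<cdot>\<^sub>m G))"
proof -
  define B where "B = block_matrix k p (\<lambda>i j. complex_of_real (t ^ (i + j - 2)) \<cdot>\<^sub>m G)"
  have Gc: "G \<in> carrier_mat k k" by (rule psd_mat_carrier[OF G])
  have index: "B $$ (a, b) = complex_of_real t ^ (a div k) * complex_of_real t ^ (b div k) * G $$ (a mod k, b mod k)"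
    if "a < p * k" "b < p * k" for a b
  proof -
    \<comment> \<open>An index below \<open>p * k\<close> excludes \<open>k = 0\<close>, so
      remainders are valid indices of \<open>G\<close>. Block numbers start at 1, so the exponent
      \<open>i + j - 2\<close> is exactly \<open>a div k + b div k\<close>, without
      truncation.\<close>
    have "k > 0" using that by (cases k) auto
    then show ?thesis using that Gc by (simp add: B_def block_matrix_def power_add)
  qed
  show ?thesis
    unfolding B_def[symmetric] psd_mat_iff
  proof (intro conjI allI impI)
    show "B \<in> carrier_mat (p * k) (p * k)" by (simp add: B_def block_matrix_def)
  next
    fix a b assume ab: "a < p * k" "b < p * k"
    then have "k > 0" by (cases k) auto
    then have "cnj (G $$ (b mod k, a mod k)) = G $$ (a mod k, b mod k)"
      by (simp add: psd_mat_cnj[OF G])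
    then show "cnj (B $$ (b, a)) = B $$ (a, b)" using ab by (simp add: index)
  next
    fix v :: "nat \<Rightarrow> complex"
    define w where "w x = (\<Sum>i<p. complex_of_real t ^ i * v (i * k + x))" for x
    let ?f = "\<lambda>i x j y. G $$ (x, y) * (complex_of_real t ^ j * v (j * k + y)) *
      cnj (complex_of_real t ^ i * v (i * k + x))"
    have "(\<Sum>a<p * k. \<Sum>b<p * k. B $$ (a, b) * v b * cnj (v a)) =
        (\<Sum>a<p * k. \<Sum>b<p * k. ?f (a div k) (a mod k) (b div k) (b mod k))"
      by (intro sum.cong refl) (simp add: index algebra_simps)
    also have "\<dots> = (\<Sum>a<p * k. \<Sum>j<p. \<Sum>y<k. ?f (a div k) (a mod k) j y)"
      by (intro sum.cong[OF refl] sum_div_mod)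
    also have "\<dots> = (\<Sum>i<p. \<Sum>x<k. \<Sum>j<p. \<Sum>y<k. ?f i x j y)"
      by (rule sum_div_mod[of "\<lambda>i x. \<Sum>j<p. \<Sum>y<k. ?f i x j y"])
    \<comment> \<open>Both block sums are moved inside the offset sums, where they act only on v and
      the powers of t and so assemble into \<open>w\<close>.\<close>
    also have "\<dots> = (\<Sum>x<k. \<Sum>i<p. \<Sum>y<k. \<Sum>j<p. ?f i x j y)"
      by (subst sum.swap) (intro sum.cong refl sum.swap)
    also have "\<dots> = (\<Sum>x<k. \<Sum>y<k. \<Sum>i<p. \<Sum>j<p. ?f i x j y)"
      by (intro sum.cong refl sum.swap)
    also have "\<dots> = (\<Sum>x<k. \<Sum>y<k. G $$ (x, y) * w y * cnj (w x))"
      unfolding w_def cnj_sum sum_distrib_left sum_distrib_right by simp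
    also have "0 \<le> \<dots>" by (rule psd_mat_form[OF G])
    finally show "0 \<le> (\<Sum>a<p * k. \<Sum>b<p * k. B $$ (a, b) * v b * cnj (v a))" .
  qed
qed

section \<open>Images of matrix powers under a positive linear map\<close>

lemma linear_mat_map_sum:
  fixes N :: nat
  assumes lin: "linear_mat_map n k \<Phi>" and P: "\<And>l. l < N \<Longrightarrow> P l \<in> carrier_mat n n"
  shows "\<Phi> (mat n n (\<lambda>(i, j). \<Sum>l<N. c l * P l $$ (i, j))) =
    mat k k (\<lambda>(i, j). \<Sum>l<N. c l * \<Phi> (P l) $$ (i, j))"
proof -
  interpret linear_map class_ring "module_mat TYPE(complex) n n" "module_mat TYPE(complex) k k" \<Phi>
    using lin unfolding linear_mat_map_def .
  have closed: "\<Phi> X \<in> carrier_mat k k" if "X \<in> carrier_mat n n" for X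
    using module_hom_closed[OF f_hom] that by (auto simp: module_mat_simps)
  have add: "\<Phi> (X + Y) = \<Phi> X + \<Phi> Y" if "X \<in> carrier_mat n n" "Y \<in> carrier_mat n n" for X Y
    using f_add[of X Y] that by (simp add: module_mat_simps)
  have smult: "\<Phi> (r \<cdot>\<^sub>m X) = r \<cdot>\<^sub>m \<Phi> X" if "X \<in> carrier_mat n n" for r X
    using f_smult[of r X] that by (simp add: module_mat_simps class_ring_simps)
  show ?thesis using P
  proof (induction N)
    case 0
    \<comment> \<open>The empty sum is the zero matrix; that it is sent to zero follows from
      homogeneity with the scalar 0.\<close>
    have "\<Phi> (0 \<cdot>\<^sub>m 0\<^sub>m n n) = 0 \<cdot>\<^sub>m \<Phi> (0\<^sub>m n n)" by (rule smult) simp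
    moreover have "mat n n (\<lambda>(i, j). \<Sum>l<0. c l * P l $$ (i, j)) = 0 \<cdot>\<^sub>m 0\<^sub>m n n" by (intro eq_matI) auto
    moreover have "0 \<cdot>\<^sub>m \<Phi> (0\<^sub>m n n) = mat k k (\<lambda>(i, j). \<Sum>l<0. c l * \<Phi> (P l) $$ (i, j))"
      using closed[of "0\<^sub>m n n"] by (intro eq_matI) auto
    ultimately show ?case by (simp only:)
  next
    case (Suc N)
    have PN: "P N \<in> carrier_mat n n" using Suc.prems by simp
    have "mat n n (\<lambda>(i, j). \<Sum>l<Suc N. c l * P l $$ (i, j)) =
        mat n n (\<lambda>(i, j). \<Sum>l<N. c l * P l $$ (i, j)) + c N \<cdot>\<^sub>m P N"
      using PN by (intro eq_matI) auto
    then have "\<Phi> (mat n n (\<lambda>(i, j). \<Sum>l<Suc N. c l * P l $$ (i, j))) =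
        mat k k (\<lambda>(i, j). \<Sum>l<N. c l * \<Phi> (P l) $$ (i, j)) + c N \<cdot>\<^sub>m \<Phi> (P N)"
      using Suc by (simp only: add[OF mat_carrier smult_carrier_mat[OF PN]] smult[OF PN] less_SucI)
    also have "\<dots> = mat k k (\<lambda>(i, j). \<Sum>l<Suc N. c l * \<Phi> (P l) $$ (i, j))"
      using closed[OF PN] by (intro eq_matI) auto
    finally show ?case .
  qed
qed

text \<open>Treats both claims at once through the shift \<open>s\<close>: the factor t^s splits off
  the exponent as a weight, and only these weights need a sign. The exponent \<open>g\<close> is
  constrained for indices from 1 on only, because with truncated subtraction
  \<open>i + j - 1\<close> and \<open>i + j - 2 + 1\<close> differ at i = j = 0.\<close>

lemma psd_block_matrix_power_moments:
  fixes d :: "nat \<Rightarrow> real"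
  assumes lin: "linear_mat_map n k \<Phi>" and pos: "positive_mat_map n k \<Phi>"
    and P: "\<And>l. l < N \<Longrightarrow> psd_mat n (P l)"
    and pow: "\<And>q. A ^\<^sub>m q = mat n n (\<lambda>(i, j). \<Sum>l<N. complex_of_real (d l ^ q) * P l $$ (i, j))"
    and s: "\<And>l. l < N \<Longrightarrow> 0 \<le> d l ^ s"
    and g: "\<And>i j. 1 \<le> i \<Longrightarrow> 1 \<le> j \<Longrightarrow> g i j = i + j - 2 + s"
  shows "psd_mat (p * k) (block_matrix k p (\<lambda>i j. \<Phi> (A ^\<^sub>m g i j)))"
proof -
  have G: "psd_mat k (\<Phi> (P l))" if "l < N" for l
    using pos P[OF that] by (simp add: positive_mat_map_def)
  let ?X = "\<lambda>l. block_matrix k p (\<lambda>i j. complex_of_real (d l ^ (i + j - 2)) \<cdot>\<^sub>m \<Phi> (P l))"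
  have "block_matrix k p (\<lambda>i j. \<Phi> (A ^\<^sub>m g i j)) =
      mat (p * k) (p * k) (\<lambda>(a, b). \<Sum>l<N. complex_of_real (d l ^ s) * ?X l $$ (a, b))"
  proof (rule eq_matI, goal_cases)
    case (1 a b)
    then have ab: "a < p * k" "b < p * k" by auto
    then have "k > 0" by (cases k) auto
    then have m: "a mod k < k" "b mod k < k" by auto
    show ?case
      using ab m carrier_matD[OF psd_mat_carrier[OF G]]
      by (auto simp: block_matrix_def pow linear_mat_map_sum[OF lin psd_mat_carrier[OF P]] g power_add
          intro!: sum.cong)
  qed (auto simp: block_matrix_def)
  then show ?thesis
    using psd_mat_sum[OF s psd_mat_hankel_kronecker[OF G]] by simp
qed

theorem corollary2p1:
  fixes n k :: nat and \<Phi> :: "complex mat \<Rightarrow> complex mat"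
    and A :: "complex mat" and m M :: real
  assumes "linear_mat_map n k \<Phi>"
    and "positive_mat_map n k \<Phi>"
    and "unital_mat_map n k \<Phi>"
    and "A \<in> carrier_mat n n"
    and "hermitian_mat A"
    and "spectrum A \<subseteq> complex_of_real ` {m..M}"
  shows "(\<forall>r::nat. psd_mat ((r + 1) * k)
            (block_matrix k (r + 1) (\<lambda>i j. \<Phi> (A ^\<^sub>m (i + j - 2)))))
       \<and> (psd_mat n A \<longrightarrow>
          (\<forall>r::nat. psd_mat ((r + 1) * k)
            (block_matrix k (r + 1) (\<lambda>i j. \<Phi> (A ^\<^sub>m (i + j - 1))))))"
proof -
  note lin = assms(1) and pos = assms(2) and A = assms(4)
  have "mat_adjoint A = A" using assms(5) by (simp add: hermitian_mat_def)
  from hermitian_unitary_diagonalization[OF A this] obtain U and d :: "nat \<Rightarrow> real"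
    where U: "U \<in> carrier_mat n n" and UU: "mat_adjoint U * U = 1\<^sub>m n"
      and AU: "A * U = U * mat n n (\<lambda>(i, j). if i = j then complex_of_real (d i) else 0)" .
  \<comment> \<open>The orthogonal projection onto the line spanned by column \<open>l\<close> of
    \<open>U\<close>.\<close>
  define P where "P l = mat n n (\<lambda>(i, j). U $$ (i, l) * cnj (U $$ (j, l)))" for l
  have P: "psd_mat n (P l)" for l
    unfolding P_def by (rule psd_mat_rank_one)
  have pow: "A ^\<^sub>m q = mat n n (\<lambda>(i, j). \<Sum>l<n. complex_of_real (d l ^ q) * P l $$ (i, j))" for q
    unfolding hermitian_pow_spectral[OF A U UU AU] by (intro eq_matI) (auto simp: P_def)
  note moments = psd_block_matrix_power_moments[OF lin pos P pow]
  \<comment> \<open>The columns of \<open>U\<close> are unit eigenvectors, so \<open>d l\<close> is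
    the value of the quadratic form of \<open>A\<close> at column \<open>l\<close>.\<close>
  have d: "0 \<le> d l" if "psd_mat n A" and l: "l < n" for l
  proof -
    have "A *\<^sub>v col U l = complex_of_real (d l) \<cdot>\<^sub>v col U l"
    proof (rule eq_vecI)
      fix i assume "i < dim_vec (complex_of_real (d l) \<cdot>\<^sub>v col U l)"
      then have i: "i < n" using U by simp
      have "(A *\<^sub>v col U l) $ i = (A * U) $$ (i, l)" using A U i l by simp
      also have "\<dots> = complex_of_real (d l) * U $$ (i, l)"
        unfolding AU by (rule mult_diag_mat_index[OF U i l])
      finally show "(A *\<^sub>v col U l) $ i = (complex_of_real (d l) \<cdot>\<^sub>v col U l) $ i"
        using U i l by simp
    qed (use A U in auto)
    moreover have "col U l \<bullet>c col U l = (mat_adjoint U * U) $$ (l, l)"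
      unfolding mat_mult_index_sum[OF mat_adjoint_carrier[OF U] U l l]
      using U l by (auto simp: scalar_prod_def atLeast0LessThan mult.commute intro!: sum.cong)
    moreover have "0 \<le> (A *\<^sub>v col U l) \<bullet>c col U l"
      using that U by (auto simp: psd_mat_def)
    ultimately show ?thesis using l U by (simp add: UU less_eq_complex_def)
  qed
  show ?thesis
  proof (intro conjI allI impI)
    fix r :: nat
    show "psd_mat ((r + 1) * k) (block_matrix k (r + 1) (\<lambda>i j. \<Phi> (A ^\<^sub>m (i + j - 2))))"
      \<comment> \<open>With shift 0 every weight is \<open>d l ^ 0 = 1\<close>, so eigenvalues of
        either sign are covered.\<close>
      by (rule moments[where s = 0]) auto
    assume "psd_mat n A"
    then show "psd_mat ((r + 1) * k) (block_matrix k (r + 1) (\<lambda>i j. \<Phi> (A ^\<^sub>m (i + j - 1))))"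
      by (intro moments[where s = 1]) (auto simp: d)
  qed
qed

end
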